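(* Let $G=(C\cup I,E)$ be a connected split graph, where $C$ induces an inclusion-maximal clique and $I$ induces an independent set. Then $h(G)=|C|$ if and only if for every two distinct vertices $x,y\in C$ there exists a vertex $z\in I$ adjacent to both $x$ and $y$. Otherwise, $h(G)=|C|-1$.
   Context: Hunters and Rabbit game on a graph $G=(V,E)$. A hunter strategy is a finite sequence $(S_1,\dots,S_\ell)$ of non-empty subsets of $V$, using $\max_i|S_i|$ hunters. A rabbit trajectory is a walk $(r_0,\dots,r_\ell)$ in $G$ ($r_i\in N(r_{i-1})$); the strategy is winning if every rabbit trajectory has some $j<\ell$ with $r_j\in S_{j+1}$. The hunter number $h(G)$ is the minimum number of hunters of a winning hunter strategy ($0$ for a single-vertex graph).
   Formalization: The graph is assumed to have at least two vertices: for the single-vertex graph the condition on pairs holds vacuously and |C| = 1, but h(G) = 0 by convention, so the claim fails there. *)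

theory Defs
  imports "Graph_Theory.Digraph_Component" "Graph_Theory.Vertex_Walk"
begin

text \<open>
  A finite simple undirected graph is an element of the locale \<open>graph\<close>, i.e. a finite,
  loop-free, symmetric digraph without parallel arcs; \<open>u\<close> and \<open>v\<close> are
  adjacent iff \<open>u \<rightarrow>\<^bsub>G\<^esub> v\<close>.
\<close>

definition clique :: "('a,'b) pre_digraph \<Rightarrow> 'a set \<Rightarrow> bool" where
  "clique G C \<longleftrightarrow> C \<subseteq> verts G \<and> (\<forall>x\<in>C. \<forall>y\<in>C. x \<noteq> y \<longrightarrow> x \<rightarrow>\<^bsub>G\<^esub> y)"

definition maximal_clique :: "('a,'b) pre_digraph \<Rightarrow> 'a set \<Rightarrow> bool" where
  "maximal_clique G C \<longleftrightarrow> clique G C \<and> \<not> (\<exists>D. clique G D \<and> C \<subset> D)"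

definition independent_set :: "('a,'b) pre_digraph \<Rightarrow> 'a set \<Rightarrow> bool" where
  "independent_set G I \<longleftrightarrow> I \<subseteq> verts G \<and> (\<forall>x\<in>I. \<forall>y\<in>I. \<not> x \<rightarrow>\<^bsub>G\<^esub> y)"

definition split_partition :: "('a,'b) pre_digraph \<Rightarrow> 'a set \<Rightarrow> 'a set \<Rightarrow> bool" where
  "split_partition G C I \<longleftrightarrow>
     verts G = C \<union> I \<and> C \<inter> I = {} \<and> maximal_clique G C \<and> independent_set G I"

text \<open>
  The list \<open>S\<close> is the sequence \<open>(S\<^sub>1, \<dots>, S\<^sub>\<ell>)\<close>, so
  \<open>S ! j\<close> is the set \<open>S\<^sub>j\<^sub>+\<^sub>1\<close>. The empty sequence is excluded so that
  the maximum in \<open>num_hunters\<close> exists; it would not be winning anyway on a graph with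
  a vertex.
\<close>

definition hunter_strategy :: "('a,'b) pre_digraph \<Rightarrow> 'a set list \<Rightarrow> bool" where
  "hunter_strategy G S \<longleftrightarrow> S \<noteq> [] \<and> (\<forall>X\<in>set S. X \<noteq> {} \<and> X \<subseteq> verts G)"

definition num_hunters :: "'a set list \<Rightarrow> nat" where
  "num_hunters S = Max (card ` set S)"

definition rabbit_trajectory :: "('a,'b) pre_digraph \<Rightarrow> nat \<Rightarrow> 'a list \<Rightarrow> bool" where
  "rabbit_trajectory G l r \<longleftrightarrow> vwalk r G \<and> vwalk_length r = l"

definition winning_strategy :: "('a,'b) pre_digraph \<Rightarrow> 'a set list \<Rightarrow> bool" where
  "winning_strategy G S \<longleftrightarrow> hunter_strategy G S \<and>
     (\<forall>r. rabbit_trajectory G (length S) r \<longrightarrow> (\<exists>j<length S. r ! j \<in> S ! j))"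

definition hunter_number :: "('a,'b) pre_digraph \<Rightarrow> nat" where
  "hunter_number G =
     (if card (verts G) = 1 then 0
      else LEAST k. \<exists>S. winning_strategy G S \<and> num_hunters S = k)"

end

theory Submission
  imports Defs
begin

text \<open>
  Follow the set \<open>R\<close> of vertices that an uncaught rabbit may occupy; a shot \<open>X\<close> turns it into
  the neighbourhood of \<open>R - X\<close>. Against fewer than \<open>|C| - 1\<close> hunters two vertices of \<open>C\<close> always
  survive, so \<open>C \<subseteq> R\<close> persists. If any two vertices of \<open>C\<close> have a common neighbour in \<open>I\<close>, then
  against \<open>|C| - 1\<close> hunters the invariant is that \<open>C \<subseteq> R\<close> and every vertex of \<open>C\<close> has a neighbour
  in \<open>I \<inter> R\<close>: one vertex of \<open>C\<close> survives each shot and re-establishes the second part, and the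
  neighbours in \<open>I \<inter> R\<close> are needed only when the shot is all of \<open>C\<close> but one vertex.
  Conversely, \<open>(C, C)\<close> is a winning strategy, and so is \<open>(C - x, C - y, C - y, C - x)\<close> if
  \<open>x, y \<in> C\<close> have no common neighbour in \<open>I\<close>.
\<close>

section \<open>The set of possible rabbit positions, and lower bounds from invariants\<close>

definition neighbours :: "('a,'b) pre_digraph \<Rightarrow> 'a set \<Rightarrow> 'a set" where
  "neighbours G A = {w. \<exists>v\<in>A. v \<rightarrow>\<^bsub>G\<^esub> w}"

lemma vwalk_nth_adj:
  assumes "vwalk r G" "Suc j < length r"
  shows "r ! j \<rightarrow>\<^bsub>G\<^esub> r ! Suc j"
  using assms
proof (induction r arbitrary: j rule: list.induct)
  case (Cons a r)
  then have ne: "r \<noteq> []" by auto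
  then have "a \<rightarrow>\<^bsub>G\<^esub> hd r" and r: "vwalk r G"
    using Cons.prems(1) by (simp_all add: vwalk_def)
  with ne Cons.IH[OF r] Cons.prems(2) show ?case
    by (cases j) (simp_all add: hd_conv_nth)
qed simp

lemma rabbit_trajectory_nth:
  assumes "rabbit_trajectory G l r"
  shows "j \<le> l \<Longrightarrow> r ! j \<in> verts G" and "j < l \<Longrightarrow> r ! j \<rightarrow>\<^bsub>G\<^esub> r ! Suc j"
proof -
  \<comment> \<open>\<open>vwalk_length\<close> counts arcs, so \<open>r\<close> lists one vertex
    more than there are shots.\<close>
  have w: "vwalk r G" and len: "length r = Suc l"
    using assms unfolding rabbit_trajectory_def by (auto simp: vwalk_def Suc_diff_le)
  show "j \<le> l \<Longrightarrow> r ! j \<in> verts G"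
    using w len by (auto simp: vwalk_def subset_iff)
  show "j < l \<Longrightarrow> r ! j \<rightarrow>\<^bsub>G\<^esub> r ! Suc j"
    using w len by (auto intro: vwalk_nth_adj)
qed

text \<open>The walk is built from its end: the rest of the walk starts in
  \<open>neighbours G (R - X)\<close>, so some vertex of \<open>R\<close> missed by \<open>X\<close>
  can be put in front of it.\<close>

lemma (in wf_digraph) evading_walk:
  assumes "Inv R"
    and "\<And>R. Inv R \<Longrightarrow> R \<inter> verts G \<noteq> {}"
    and "\<And>R X. Inv R \<Longrightarrow> X \<in> set S \<Longrightarrow> Inv (neighbours G (R - X))"
  shows "\<exists>r. vwalk r G \<and> length r = Suc (length S) \<and> hd r \<in> R \<and> (\<forall>j<length S. r ! j \<notin> S ! j)"
  using assms(1,3)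
proof (induction S arbitrary: R)
  case Nil
  then obtain v where "v \<in> R" "v \<in> verts G" using assms(2) by blast
  then show ?case by (intro exI[of _ "[v]"]) (auto simp: vwalk_def)
next
  case (Cons X S)
  have "Inv (neighbours G (R - X))" using Cons.prems by simp
  then obtain r where r: "vwalk r G" "length r = Suc (length S)"
      "hd r \<in> neighbours G (R - X)" "\<forall>j<length S. r ! j \<notin> S ! j"
    using Cons.IH Cons.prems(2) by (meson list.set_intros(2))
  then obtain v where v: "v \<in> R - X" "v \<rightarrow>\<^bsub>G\<^esub> hd r" by (auto simp: neighbours_def)
  have "vwalk (v # r) G"
    using r(1) v(2) by (intro vwalk_consI) (auto simp: adj_in_verts)
  with r v show ?case
    by (intro exI[of _ "v # r"]) (auto simp: nth_Cons split: nat.split)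
qed

text \<open>With fewer than \<open>k\<close> hunters every shot has size below \<open>k\<close>, so
  \<open>Inv\<close> persists and the rabbit has an evading walk through the whole strategy.\<close>

lemma (in fin_digraph) num_hunters_ge_if_invariant:
  assumes "Inv (verts G)"
    and "\<And>R. Inv R \<Longrightarrow> R \<inter> verts G \<noteq> {}"
    and "\<And>R X. Inv R \<Longrightarrow> finite X \<Longrightarrow> card X < k \<Longrightarrow> Inv (neighbours G (R - X))"
    and win: "winning_strategy G S"
  shows "k \<le> num_hunters S"
proof (rule ccontr)
  assume "\<not> k \<le> num_hunters S"
  moreover have "card X \<le> num_hunters S" if "X \<in> set S" for X
    using that by (simp add: num_hunters_def)
  ultimately have "finite X \<and> card X < k" if "X \<in> set S" for X
    using that win by (fastforce simp: winning_strategy_def hunter_strategy_def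
        intro: finite_subset[OF _ finite_verts])
  then obtain r where "vwalk r G" "length r = Suc (length S)" "\<forall>j<length S. r ! j \<notin> S ! j"
    using evading_walk[of Inv "verts G" S, OF assms(1,2)] assms(3) by blast
  with win show False by (auto simp: winning_strategy_def rabbit_trajectory_def)
qed

lemma hunter_number_eqI:
  assumes "card (verts G) \<noteq> 1"
    and "winning_strategy G S" "num_hunters S = k"
    and "\<And>S. winning_strategy G S \<Longrightarrow> k \<le> num_hunters S"
  shows "hunter_number G = k"
  using assms unfolding hunter_number_def by (auto intro!: Least_equality)

section \<open>Connected split graphs with at least two vertices\<close>

locale split_graph = graph G for G :: "('a,'b) pre_digraph" (structure) +
  fixes C I :: "'a set"
  assumes conn: "connected G"
    and card_verts: "card (verts G) \<ge> 2"
    and split: "split_partition G C I"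
begin

lemma verts_eq: "verts G = C \<union> I"
  using split by (simp add: split_partition_def)

lemma finite_C: "finite C"
  using finite_verts verts_eq by (metis finite_Un)

lemma adj_sym: "u \<rightarrow> v \<Longrightarrow> v \<rightarrow> u"
  using sym_arcs by (rule arcs_ends_symmetric)

lemma C_adj: "x \<in> C \<Longrightarrow> y \<in> C \<Longrightarrow> x \<noteq> y \<Longrightarrow> x \<rightarrow> y"
  using split by (auto simp: split_partition_def maximal_clique_def clique_def)

lemma adj_I_imp_C: "u \<rightarrow> v \<Longrightarrow> u \<in> I \<Longrightarrow> v \<in> C"
  using split verts_eq adj_in_verts(2)[of u v]
  by (auto simp: split_partition_def independent_set_def)

text \<open>A smaller clique is not maximal: any vertex extends the empty one, and by connectedness
  \<open>{c}\<close> extends by a neighbour of \<open>c\<close>.\<close>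

lemma card_C: "card C \<ge> 2"
proof (rule ccontr)
  have max: "\<not> (clique G D \<and> C \<subset> D)" for D
    using split by (auto simp: split_partition_def maximal_clique_def)
  obtain u where u: "u \<in> verts G"
    using card_verts by fastforce
  assume "\<not> card C \<ge> 2"
  then have "card C = 0 \<or> card C = 1" by linarith
  then consider "C = {}" | c where "C = {c}"
    using finite_C by (auto simp: card_1_singleton_iff)
  then show False
  proof cases
    case 1
    then show False using max[of "{u}"] u by (auto simp: clique_def)
  next
    case (2 c)
    have "verts G \<noteq> {c}" using card_verts by auto
    then obtain w where w: "w \<in> verts G" "w \<noteq> c" and c: "c \<in> verts G"
      using 2 verts_eq by auto
    have "c \<rightarrow>\<^sup>* w" using symmetric_connected_imp_strongly_connected[OF sym_arcs conn] w c
      by (auto simp: strongly_connected_def)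
    then obtain v where v: "c \<rightarrow> v"
      using w by (auto elim: converse_reachable_cases)
    then have "clique G {c, v}"
      using adj_sym adj_in_verts by (auto simp: clique_def)
    then show False using max[of "{c, v}"] 2 v adj_not_same by auto
  qed
qed

lemma card_verts_neq: "card (verts G) \<noteq> 1"
  using card_verts by simp

lemma other_C:
  obtains y where "y \<in> C" "y \<noteq> x"
proof -
  have "\<not> C \<subseteq> {x}"
    using card_C card_mono[of "{x}" C] by auto
  with that show ?thesis by blast
qed

lemma survivor:
  assumes "finite X" "card X < card C"
  obtains x where "x \<in> C" "x \<notin> X"
  using assms card_mono[of X C] by (meson not_le subsetI)

lemma survivors:
  assumes "finite X" "card X < card C - 1"
  obtains x y where "x \<in> C" "x \<notin> X" "y \<in> C" "y \<notin> X" "x \<noteq> y"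
proof -
  have "card X < card C" using assms by simp
  then obtain x where x: "x \<in> C" "x \<notin> X" using survivor assms by blast
  have "finite (insert x X)" "card (insert x X) < card C" using assms x by auto
  then obtain y where "y \<in> C" "y \<notin> insert x X" by (rule survivor)
  with x that show ?thesis by auto
qed

section \<open>Lower bounds on the number of hunters\<close>

lemma num_hunters_ge:
  assumes "winning_strategy G S"
  shows "card C - 1 \<le> num_hunters S"
proof (rule num_hunters_ge_if_invariant[where Inv = "\<lambda>R. C \<subseteq> R"])
  show "C \<subseteq> verts G" using verts_eq by blast
  show "R \<inter> verts G \<noteq> {}" if "C \<subseteq> R" for R
    using that verts_eq other_C by (metis Un_iff disjoint_iff subsetD)
  show "C \<subseteq> neighbours G (R - X)"
    if "C \<subseteq> R" and X: "finite X" "card X < card C - 1" for R X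
  proof
    fix w assume "w \<in> C"
    \<comment> \<open>No vertex is adjacent to itself, so one survivor might be \<open>w\<close>; of
      two, at least one differs from \<open>w\<close> and leads to it.\<close>
    obtain x y where "x \<in> C" "x \<notin> X" "y \<in> C" "y \<notin> X" "x \<noteq> y"
      using survivors[OF X] .
    with \<open>w \<in> C\<close> \<open>C \<subseteq> R\<close> show "w \<in> neighbours G (R - X)"
      using C_adj[of x w] C_adj[of y w] by (cases "w = x") (auto simp: neighbours_def)
  qed
  show "winning_strategy G S" by fact
qed

lemma num_hunters_ge_if_common_neighbours:
  assumes common: "\<And>x y. x \<in> C \<Longrightarrow> y \<in> C \<Longrightarrow> x \<noteq> y \<Longrightarrow> \<exists>z\<in>I. z \<rightarrow> x \<and> z \<rightarrow> y"
    and "winning_strategy G S"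
  shows "card C \<le> num_hunters S"
proof (rule num_hunters_ge_if_invariant
    [where Inv = "\<lambda>R. C \<subseteq> R \<and> (\<forall>x\<in>C. \<exists>z\<in>I \<inter> R. z \<rightarrow> x)"])
  \<comment> \<open>Distinctness is dropped: for \<open>w = x\<close>, a common neighbour of
    \<open>x\<close> and another vertex of \<open>C\<close> serves.\<close>
  have nbr: "\<exists>z\<in>I. z \<rightarrow> w \<and> z \<rightarrow> x" if "w \<in> C" "x \<in> C" for w x
    using common that by (metis other_C)
  show "C \<subseteq> verts G \<and> (\<forall>x\<in>C. \<exists>z\<in>I \<inter> verts G. z \<rightarrow> x)"
    using verts_eq nbr by blast
  show "R \<inter> verts G \<noteq> {}" if "C \<subseteq> R \<and> (\<forall>x\<in>C. \<exists>z\<in>I \<inter> R. z \<rightarrow> x)" for R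
    using that verts_eq other_C by (metis Un_iff disjoint_iff subsetD)
  show "C \<subseteq> neighbours G (R - X) \<and> (\<forall>x\<in>C. \<exists>z\<in>I \<inter> neighbours G (R - X). z \<rightarrow> x)"
    if R: "C \<subseteq> R \<and> (\<forall>x\<in>C. \<exists>z\<in>I \<inter> R. z \<rightarrow> x)" and X: "finite X" "card X < card C" for R X
  proof
    obtain x where x: "x \<in> C" "x \<notin> X" using survivor[OF X] .
    then have x': "x \<in> R - X" using R by blast
    show "\<forall>w\<in>C. \<exists>z\<in>I \<inter> neighbours G (R - X). z \<rightarrow> w"
    proof
      fix w assume "w \<in> C"
      then obtain z where "z \<in> I" "z \<rightarrow> w" "z \<rightarrow> x" using nbr x by blast
      moreover from this have "x \<rightarrow> z" by (auto intro: adj_sym)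
      ultimately show "\<exists>z\<in>I \<inter> neighbours G (R - X). z \<rightarrow> w"
        using x' by (auto simp: neighbours_def)
    qed
    \<comment> \<open>The survivor \<open>x\<close> leads to all of \<open>C\<close> except itself,
      so only \<open>x\<close> needs another predecessor.\<close>
    have "x \<in> neighbours G (R - X)"
    proof (cases "\<exists>y\<in>C. y \<noteq> x \<and> y \<notin> X")
      case True
      then show ?thesis using R x C_adj by (auto simp: neighbours_def)
    next
      case False
      then have "C - {x} \<subseteq> X" by blast
      \<comment> \<open>The hunters suffice for \<open>C - {x}\<close> and nothing more, so no
        vertex of \<open>I\<close> is shot and \<open>z\<close> can lead to
        \<open>x\<close>.\<close>
      moreover have "card X \<le> card (C - {x})" using X(2) x finite_C by simp
      ultimately have "X = C - {x}" using X(1) by (metis card_seteq)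
      moreover have "C \<inter> I = {}" using split by (simp add: split_partition_def)
      moreover obtain z where "z \<in> I \<inter> R" "z \<rightarrow> x" using R x by blast
      ultimately show ?thesis by (auto simp: neighbours_def)
    qed
    then show "C \<subseteq> neighbours G (R - X)"
      using x x' C_adj unfolding neighbours_def by blast
  qed
  show "winning_strategy G S" by fact
qed

section \<open>Winning strategies\<close>

lemma winning_C_C: "winning_strategy G [C, C]"
proof -
  have "hunter_strategy G [C, C]"
    using verts_eq other_C by (auto simp: hunter_strategy_def)
  moreover have "\<exists>j<2. r ! j \<in> [C, C] ! j" if "rabbit_trajectory G 2 r" for r
  proof -
    have "r ! 0 \<in> C \<union> I" "r ! 0 \<rightarrow> r ! 1"
      using rabbit_trajectory_nth[OF that, of 0] verts_eq by auto
    \<comment> \<open>Every edge has an end in \<open>C\<close>, so the rabbit cannot avoid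
      \<open>C\<close> at two consecutive times.\<close>
    then have "r ! 0 \<in> C \<or> r ! 1 \<in> C" using adj_I_imp_C by blast
    then show ?thesis by (auto simp: less_2_cases_iff)
  qed
  ultimately show ?thesis by (simp add: winning_strategy_def eval_nat_numeral)
qed

text \<open>The first two shots force an uncaught rabbit to be at a neighbour of \<open>y\<close> in
  \<open>I\<close> at time 2. It must then return to \<open>C\<close>, where the last shot spares
  only \<open>x\<close>, so that neighbour would be common to \<open>x\<close> and
  \<open>y\<close>.\<close>

lemma winning_if_no_common_neighbour:
  assumes x: "x \<in> C" and y: "y \<in> C" and neq: "x \<noteq> y"
    and none: "\<not> (\<exists>z\<in>I. z \<rightarrow> x \<and> z \<rightarrow> y)"
  shows "winning_strategy G [C - {x}, C - {y}, C - {y}, C - {x}]" (is "winning_strategy G ?S")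
proof -
  have "hunter_strategy G ?S"
    using verts_eq x y neq by (auto simp: hunter_strategy_def)
  moreover have "\<exists>j<4. r ! j \<in> ?S ! j" if "rabbit_trajectory G 4 r" for r
  proof (rule ccontr)
    assume "\<not> (\<exists>j<4. r ! j \<in> ?S ! j)"
    then have free: "r ! j \<notin> ?S ! j" if "j < 4" for j using that by blast
    note f = free[of 0, simplified] free[of 1, simplified] free[of 2, simplified] free[of 3, simplified]
    have v: "r ! j \<in> C \<union> I" if "j \<le> 4" for j
      using rabbit_trajectory_nth(1)[OF \<open>rabbit_trajectory G 4 r\<close> that] verts_eq by simp
    have a: "r ! 0 \<rightarrow> r ! 1" "r ! 1 \<rightarrow> r ! 2" "r ! 2 \<rightarrow> r ! 3"
      using rabbit_trajectory_nth(2)[OF that, of 0] rabbit_trajectory_nth(2)[OF that, of 1]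
        rabbit_trajectory_nth(2)[OF that, of 2] by (simp_all add: numeral_2_eq_2 numeral_3_eq_3)
    have 0: "r ! 0 = x \<or> r ! 0 \<in> I" using f v[of 0] by auto
    \<comment> \<open>If \<open>r ! 1\<close> lies in \<open>I\<close>, then \<open>r ! 0\<close>
      does not, which leaves \<open>r ! 0 = x\<close>.\<close>
    have 1: "r ! 1 = y \<or> r ! 1 \<in> I \<and> r ! 1 \<rightarrow> x"
      using f v[of 1] 0 a(1) adj_I_imp_C adj_sym by auto
    have 2: "r ! 2 \<in> I \<and> r ! 2 \<rightarrow> y"
      using 1
    proof
      assume "r ! 1 = y"
      moreover from this have "r ! 2 \<noteq> y" using a(2) adj_not_same by auto
      ultimately show ?thesis using a(2) f v[of 2] adj_sym by auto
    next
      \<comment> \<open>This case is contradictory: the third shot leaves only \<open>y\<close>,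
        making \<open>r ! 1\<close> a common neighbour of \<open>x\<close> and
        \<open>y\<close>.\<close>
      assume z: "r ! 1 \<in> I \<and> r ! 1 \<rightarrow> x"
      then have "r ! 2 \<in> C" using a(2) adj_I_imp_C by blast
      then have "r ! 2 = y" using f by auto
      then show ?thesis using z a(2) none by auto
    qed
    then have "r ! 3 \<in> C" using a(3) adj_I_imp_C by blast
    then have "r ! 3 = x" using f by auto
    then show False using 2 a(3) none by auto
  qed
  ultimately show ?thesis by (simp add: winning_strategy_def eval_nat_numeral)
qed

lemma hunter_number_if_common_neighbours:
  assumes "\<And>x y. x \<in> C \<Longrightarrow> y \<in> C \<Longrightarrow> x \<noteq> y \<Longrightarrow> \<exists>z\<in>I. z \<rightarrow> x \<and> z \<rightarrow> y"
  shows "hunter_number G = card C"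
  using card_verts_neq winning_C_C
proof (rule hunter_number_eqI)
  show "num_hunters [C, C] = card C" by (simp add: num_hunters_def)
qed (use num_hunters_ge_if_common_neighbours assms in blast)

lemma hunter_number_if_no_common_neighbour:
  assumes "x \<in> C" "y \<in> C" "x \<noteq> y" "\<not> (\<exists>z\<in>I. z \<rightarrow> x \<and> z \<rightarrow> y)"
  shows "hunter_number G = card C - 1"
  using card_verts_neq winning_if_no_common_neighbour[OF assms]
proof (rule hunter_number_eqI)
  show "num_hunters [C - {x}, C - {y}, C - {y}, C - {x}] = card C - 1"
    using assms by (simp add: num_hunters_def)
qed (rule num_hunters_ge)

end

theorem theorem4p3:
  fixes G :: "('a,'b) pre_digraph" and C I :: "'a set"
  assumes "graph G"
    and "connected G"
    and "card (verts G) \<ge> 2"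
    and "split_partition G C I"
  shows "(hunter_number G = card C \<longleftrightarrow>
            (\<forall>x\<in>C. \<forall>y\<in>C. x \<noteq> y \<longrightarrow> (\<exists>z\<in>I. z \<rightarrow>\<^bsub>G\<^esub> x \<and> z \<rightarrow>\<^bsub>G\<^esub> y))) \<and>
         (\<not> (\<forall>x\<in>C. \<forall>y\<in>C. x \<noteq> y \<longrightarrow> (\<exists>z\<in>I. z \<rightarrow>\<^bsub>G\<^esub> x \<and> z \<rightarrow>\<^bsub>G\<^esub> y)) \<longrightarrow>
            hunter_number G = card C - 1)"
proof -
  interpret split_graph G C I
    using assms by (simp add: split_graph_def split_graph_axioms_def)
  \<comment> \<open>Subtraction on \<open>nat\<close> truncates, so \<open>C\<close> must be
    non-empty for the two values to differ; this gives the forward direction of the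
    equivalence.\<close>
  have "card C - 1 \<noteq> card C" using card_C by simp
  then show ?thesis
    using hunter_number_if_common_neighbours hunter_number_if_no_common_neighbour by metis
qed

end
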